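(* Let $M$ be a totally umbilical proper slant submanifold of a Kenmotsu manifold $(\bar M,\phi,\xi,\eta,g)$. Then $M$ is totally geodesic in $\bar M$.
   Context: An almost contact metric manifold is a $(2n+1)$-dimensional Riemannian manifold $(\bar M,g)$ with an endomorphism $\phi$ of $T\bar M$, a vector field $\xi$ (the structure vector field) and a $1$-form $\eta$ satisfying $$\phi^2=-I+\eta\otimes\xi,\quad \eta(\xi)=1,\quad \phi(\xi)=0,\quad \eta\circ\phi=0,$$ $$g(\phi X,\phi Y)=g(X,Y)-\eta(X)\eta(Y),\quad \eta(X)=g(X,\xi)$$ for all $X,Y$ tangent to $\bar M$. It is a Kenmotsu manifold if, with $\bar\nabla$ the Levi-Civita connection of $g$, $$(\bar\nabla_X\phi)Y=g(\phi X,Y)\xi-\eta(Y)\phi X,\qquad \bar\nabla_X\xi=X-\eta(X)\xi$$ for all vector fields $X,Y$ on $\bar M$, where $(\bar\nabla_X\phi)Y=\bar\nabla_X\phi Y-\phi\bar\nabla_XY$. Let $M$ be a submanifold of $\bar M$ with the induced metric (also denoted $g$), tangent bundle $TM$, and second fundamental form $h$, defined by the Gauss formula $\bar\nabla_XY=\nabla_XY+h(X,Y)$ for $X,Y\in\Gamma(TM)$, with $\nabla$ the induced connection. The submanifold $M$ is totally umbilical if $h(X,Y)=g(X,Y)H$ for all $X,Y\in\Gamma(TM)$, where $H$ is the mean curvature vector of $M$; it is totally geodesic if $h=0$. For $X\in\Gamma(TM)$ write $\phi X=TX+FX$ with $TX$ tangent and $FX$ normal to $M$. $M$ is slant if $\xi$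 is tangent to $M$ and, for all $x\in M$ and $X\in T_xM-\langle\xi\rangle$, the angle between $\phi X$ and $T_xM$ is a constant $\theta\in[0,\pi/2]$ (independent of $x$ and $X$), called the slant angle. $M$ is invariant if $FX=0$ for all $X\in\Gamma(TM)$ (slant angle $0$), anti-invariant if $TX=0$ for all $X\in\Gamma(TM)$ (slant angle $\pi/2$), and proper slant if it is slant and neither invariant nor anti-invariant. *)

theory Defs
  imports "HOL-Analysis.Analysis"
begin

section \<open>Smooth manifolds\<close>

text \<open>A smooth manifold is a Hausdorff, second countable type with an atlas (not necessarily
  maximal) of charts \<open>(U, c)\<close> into a Euclidean space \<open>'e\<close>; its dimension is \<open>DIM('e)\<close>.
  The sets \<open>S\<close> below are always open.\<close>

primrec Ck_on :: "nat \<Rightarrow> 'e::euclidean_space set \<Rightarrow> ('e \<Rightarrow> 'v::real_normed_vector) \<Rightarrow> bool" where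
  "Ck_on 0 S f \<longleftrightarrow> continuous_on S f"
| "Ck_on (Suc k) S f \<longleftrightarrow> (\<forall>x\<in>S. f differentiable (at x)) \<and>
     (\<forall>v. Ck_on k S (\<lambda>x. frechet_derivative f (at x) v))"

definition smooth_on :: "'e::euclidean_space set \<Rightarrow> ('e \<Rightarrow> 'v::real_normed_vector) \<Rightarrow> bool" where
  "smooth_on S f \<longleftrightarrow> (\<forall>k. Ck_on k S f)"

type_synonym ('a, 'e) atlas = "('a set \<times> ('a \<Rightarrow> 'e)) set"

definition smooth_manifold ::
  "('a::{t2_space,second_countable_topology}, 'e::euclidean_space) atlas \<Rightarrow> bool" where
  "smooth_manifold A \<longleftrightarrow>
     \<Union>(fst ` A) = UNIV \<and>
     (\<forall>(U, c)\<in>A. open U \<and> open (c ` U) \<and> homeomorphism U (c ` U) c (inv_into U c)) \<and>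
     (\<forall>(U, c)\<in>A. \<forall>(V, d)\<in>A. smooth_on (c ` (U \<inter> V)) (d \<circ> inv_into U c))"

definition smooth_fun_on ::
  "('a::topological_space, 'e::euclidean_space) atlas \<Rightarrow> 'a set \<Rightarrow> ('a \<Rightarrow> real) \<Rightarrow> bool" where
  "smooth_fun_on A S f \<longleftrightarrow> (\<forall>(U, c)\<in>A. smooth_on (c ` (U \<inter> S)) (f \<circ> inv_into U c))"

definition smooth_at ::
  "('a::topological_space, 'e::euclidean_space) atlas \<Rightarrow> 'a \<Rightarrow> ('a \<Rightarrow> real) \<Rightarrow> bool" where
  "smooth_at A p f \<longleftrightarrow> (\<exists>S. open S \<and> p \<in> S \<and> smooth_fun_on A S f)"

text \<open>Tangent vectors at \<open>p\<close> are derivations of the algebra of germs of smooth functions at \<open>p\<close>.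
  They are represented by functionals on all functions which depend only on the germ and take
  the value 0 on functions that are not smooth near \<open>p\<close>, so that equal derivations are equal
  as functionals. The linear structure is the pointwise one, the zero vector being
  \<open>\<lambda>_. 0\<close>.\<close>

type_synonym 'a tvec = "('a \<Rightarrow> real) \<Rightarrow> real"
type_synonym 'a vfield = "'a \<Rightarrow> 'a tvec"

definition tcomb :: "real \<Rightarrow> 'a tvec \<Rightarrow> real \<Rightarrow> 'a tvec \<Rightarrow> 'a tvec" where
  "tcomb a u b v = (\<lambda>f. a * u f + b * v f)"

definition tangent_space ::
  "('a::topological_space, 'e::euclidean_space) atlas \<Rightarrow> 'a \<Rightarrow> 'a tvec set" where
  "tangent_space A p = {v.
     (\<forall>f. \<not> smooth_at A p f \<longrightarrow> v f = 0) \<and>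
     (\<forall>f h. smooth_at A p f \<and> smooth_at A p h \<longrightarrow>
        (\<forall>a b. v (\<lambda>q. a * f q + b * h q) = a * v f + b * v h) \<and>
        v (\<lambda>q. f q * h q) = v f * h p + f p * v h \<and>
        (\<forall>S. open S \<and> p \<in> S \<and> (\<forall>q\<in>S. f q = h q) \<longrightarrow> v f = v h))}"

definition vector_field ::
  "('a::topological_space, 'e::euclidean_space) atlas \<Rightarrow> 'a vfield \<Rightarrow> bool" where
  "vector_field A X \<longleftrightarrow>
     (\<forall>p. X p \<in> tangent_space A p) \<and>
     (\<forall>S f. open S \<and> smooth_fun_on A S f \<longrightarrow> smooth_fun_on A S (\<lambda>p. X p f))"

definition lie_bracket ::
  "('a::topological_space, 'e::euclidean_space) atlas \<Rightarrow> 'a vfield \<Rightarrow> 'a vfield \<Rightarrow> 'a vfield" where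
  "lie_bracket A X Y = (\<lambda>p f. if smooth_at A p f
     then X p (\<lambda>q. Y q f) - Y p (\<lambda>q. X q f) else 0)"


section \<open>Riemannian metrics and the Levi-Civita connection\<close>

text \<open>A metric is given as \<open>g p u v\<close>, for \<open>u\<close> and \<open>v\<close> tangent at \<open>p\<close>. Smoothness of a tensor
  field means that it takes smooth vector fields to smooth functions or vector fields.\<close>

type_synonym 'a metric = "'a \<Rightarrow> 'a tvec \<Rightarrow> 'a tvec \<Rightarrow> real"

definition riemannian_metric ::
  "('a::topological_space, 'e::euclidean_space) atlas \<Rightarrow> 'a metric \<Rightarrow> bool" where
  "riemannian_metric A g \<longleftrightarrow>
     (\<forall>p. \<forall>u\<in>tangent_space A p. \<forall>v\<in>tangent_space A p.
        g p u v = g p v u \<and>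
        (\<forall>w\<in>tangent_space A p. \<forall>a b. g p (tcomb a u b v) w = a * g p u w + b * g p v w) \<and>
        (u \<noteq> (\<lambda>_. 0) \<longrightarrow> g p u u > 0)) \<and>
     (\<forall>X Y. vector_field A X \<and> vector_field A Y \<longrightarrow>
        smooth_fun_on A UNIV (\<lambda>p. g p (X p) (Y p)))"

definition affine_connection ::
  "('a::topological_space, 'e::euclidean_space) atlas \<Rightarrow>
     ('a vfield \<Rightarrow> 'a vfield \<Rightarrow> 'a vfield) \<Rightarrow> bool" where
  "affine_connection A D \<longleftrightarrow>
     (\<forall>X Y. vector_field A X \<and> vector_field A Y \<longrightarrow> vector_field A (D X Y)) \<and>
     (\<forall>X Y Z. vector_field A X \<and> vector_field A Y \<and> vector_field A Z \<longrightarrow>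
        D (\<lambda>p. tcomb 1 (X p) 1 (Y p)) Z = (\<lambda>p. tcomb 1 (D X Z p) 1 (D Y Z p)) \<and>
        D X (\<lambda>p. tcomb 1 (Y p) 1 (Z p)) = (\<lambda>p. tcomb 1 (D X Y p) 1 (D X Z p))) \<and>
     (\<forall>X Y k. vector_field A X \<and> vector_field A Y \<and> smooth_fun_on A UNIV k \<longrightarrow>
        D (\<lambda>p f. k p * X p f) Y = (\<lambda>p f. k p * D X Y p f) \<and>
        D X (\<lambda>p f. k p * Y p f) = (\<lambda>p. tcomb (k p) (D X Y p) (X p k) (Y p)))"

definition levi_civita_connection ::
  "('a::topological_space, 'e::euclidean_space) atlas \<Rightarrow> 'a metric \<Rightarrow>
     ('a vfield \<Rightarrow> 'a vfield \<Rightarrow> 'a vfield) \<Rightarrow> bool" where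
  "levi_civita_connection A g D \<longleftrightarrow>
     affine_connection A D \<and>
     (\<forall>X Y. vector_field A X \<and> vector_field A Y \<longrightarrow>
        (\<lambda>p. tcomb 1 (D X Y p) (-1) (D Y X p)) = lie_bracket A X Y) \<and>
     (\<forall>X Y Z. vector_field A X \<and> vector_field A Y \<and> vector_field A Z \<longrightarrow>
        (\<forall>p. X p (\<lambda>q. g q (Y q) (Z q)) = g p (D X Y p) (Z p) + g p (Y p) (D X Z p)))"


section \<open>Kenmotsu manifolds\<close>

definition almost_contact_metric_manifold ::
  "('a::{t2_space,second_countable_topology}, 'e::euclidean_space) atlas \<Rightarrow>
     ('a \<Rightarrow> 'a tvec \<Rightarrow> 'a tvec) \<Rightarrow> 'a vfield \<Rightarrow> ('a \<Rightarrow> 'a tvec \<Rightarrow> real) \<Rightarrow> 'a metric \<Rightarrow> bool" where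
  "almost_contact_metric_manifold A \<phi> \<xi> \<eta> g \<longleftrightarrow>
     smooth_manifold A \<and> (\<exists>n. DIM('e) = 2 * n + 1) \<and> riemannian_metric A g \<and>
     vector_field A \<xi> \<and>
     (\<forall>p. \<forall>u\<in>tangent_space A p. \<phi> p u \<in> tangent_space A p) \<and>
     (\<forall>p. \<forall>u\<in>tangent_space A p. \<forall>v\<in>tangent_space A p. \<forall>a b.
        \<phi> p (tcomb a u b v) = tcomb a (\<phi> p u) b (\<phi> p v) \<and>
        \<eta> p (tcomb a u b v) = a * \<eta> p u + b * \<eta> p v) \<and>
     (\<forall>X. vector_field A X \<longrightarrow> vector_field A (\<lambda>p. \<phi> p (X p)) \<and>
        smooth_fun_on A UNIV (\<lambda>p. \<eta> p (X p))) \<and>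
     (\<forall>p. \<eta> p (\<xi> p) = 1 \<and> \<phi> p (\<xi> p) = (\<lambda>_. 0)) \<and>
     (\<forall>p. \<forall>u\<in>tangent_space A p.
        \<phi> p (\<phi> p u) = tcomb (-1) u (\<eta> p u) (\<xi> p) \<and>
        \<eta> p (\<phi> p u) = 0 \<and> \<eta> p u = g p u (\<xi> p)) \<and>
     (\<forall>p. \<forall>u\<in>tangent_space A p. \<forall>v\<in>tangent_space A p.
        g p (\<phi> p u) (\<phi> p v) = g p u v - \<eta> p u * \<eta> p v)"

definition kenmotsu_manifold ::
  "('a::{t2_space,second_countable_topology}, 'e::euclidean_space) atlas \<Rightarrow>
     ('a \<Rightarrow> 'a tvec \<Rightarrow> 'a tvec) \<Rightarrow> 'a vfield \<Rightarrow> ('a \<Rightarrow> 'a tvec \<Rightarrow> real) \<Rightarrow> 'a metric \<Rightarrow>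
     ('a vfield \<Rightarrow> 'a vfield \<Rightarrow> 'a vfield) \<Rightarrow> bool" where
  "kenmotsu_manifold A \<phi> \<xi> \<eta> g D \<longleftrightarrow>
     almost_contact_metric_manifold A \<phi> \<xi> \<eta> g \<and> levi_civita_connection A g D \<and>
     (\<forall>X Y. vector_field A X \<and> vector_field A Y \<longrightarrow> (\<forall>p.
        tcomb 1 (D X (\<lambda>q. \<phi> q (Y q)) p) (-1) (\<phi> p (D X Y p))
          = tcomb (g p (\<phi> p (X p)) (Y p)) (\<xi> p) (- \<eta> p (Y p)) (\<phi> p (X p)))) \<and>
     (\<forall>X. vector_field A X \<longrightarrow> (\<forall>p. D X \<xi> p = tcomb 1 (X p) (- \<eta> p (X p)) (\<xi> p)))"


section \<open>Submanifolds\<close>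

text \<open>A submanifold is a manifold (atlas \<open>B\<close> on a type \<open>'b\<close>) with a smooth immersion \<open>\<iota>\<close> into
  the ambient manifold, which carries the induced metric. Immersed and embedded submanifolds
  are the case of an injective \<open>\<iota>\<close>.\<close>

definition smooth_map ::
  "('b::topological_space, 'd::euclidean_space) atlas \<Rightarrow>
     ('a::topological_space, 'e::euclidean_space) atlas \<Rightarrow> ('b \<Rightarrow> 'a) \<Rightarrow> bool" where
  "smooth_map B A \<iota> \<longleftrightarrow> continuous_on UNIV \<iota> \<and>
     (\<forall>(U, c)\<in>B. \<forall>(V, d)\<in>A. smooth_on (c ` (U \<inter> \<iota> -` V)) (d \<circ> \<iota> \<circ> inv_into U c))"

definition differential ::
  "('a::topological_space, 'e::euclidean_space) atlas \<Rightarrow> ('b \<Rightarrow> 'a) \<Rightarrow> 'b \<Rightarrow> 'b tvec \<Rightarrow> 'a tvec" where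
  "differential A \<iota> x u = (\<lambda>f. if smooth_at A (\<iota> x) f then u (f \<circ> \<iota>) else 0)"

definition immersed_submanifold ::
  "('a::{t2_space,second_countable_topology}, 'e::euclidean_space) atlas \<Rightarrow>
     ('b::{t2_space,second_countable_topology}, 'd::euclidean_space) atlas \<Rightarrow> ('b \<Rightarrow> 'a) \<Rightarrow> bool" where
  "immersed_submanifold A B \<iota> \<longleftrightarrow>
     smooth_manifold A \<and> smooth_manifold B \<and> smooth_map B A \<iota> \<and>
     (\<forall>x. inj_on (differential A \<iota> x) (tangent_space B x))"

text \<open>As usual, \<open>T\<^sub>xM\<close> is regarded as a subspace of the ambient tangent space at \<open>\<iota> x\<close>, and
  \<open>\<Gamma>(TM)\<close> as the set of those smooth sections of the ambient tangent bundle restricted to \<open>M\<close>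
  (\<open>fields_along\<close>) that are tangent to \<open>M\<close>.\<close>

definition sub_tangent ::
  "('a::topological_space, 'e::euclidean_space) atlas \<Rightarrow>
     ('b::topological_space, 'd::euclidean_space) atlas \<Rightarrow> ('b \<Rightarrow> 'a) \<Rightarrow> 'b \<Rightarrow> 'a tvec set" where
  "sub_tangent A B \<iota> x = differential A \<iota> x ` tangent_space B x"

definition fields_along ::
  "('a::topological_space, 'e::euclidean_space) atlas \<Rightarrow>
     ('b::topological_space, 'd::euclidean_space) atlas \<Rightarrow> ('b \<Rightarrow> 'a) \<Rightarrow> ('b \<Rightarrow> 'a tvec) set" where
  "fields_along A B \<iota> = {X.
     (\<forall>x. X x \<in> tangent_space A (\<iota> x)) \<and>
     (\<forall>S f. open S \<and> smooth_fun_on A S f \<longrightarrow> smooth_fun_on B (\<iota> -` S) (\<lambda>x. X x f))}"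

definition tangent_fields ::
  "('a::topological_space, 'e::euclidean_space) atlas \<Rightarrow>
     ('b::topological_space, 'd::euclidean_space) atlas \<Rightarrow> ('b \<Rightarrow> 'a) \<Rightarrow> ('b \<Rightarrow> 'a tvec) set" where
  "tangent_fields A B \<iota> = {X \<in> fields_along A B \<iota>. \<forall>x. X x \<in> sub_tangent A B \<iota> x}"

definition tangential_part ::
  "('a::topological_space, 'e::euclidean_space) atlas \<Rightarrow>
     ('b::topological_space, 'd::euclidean_space) atlas \<Rightarrow> ('b \<Rightarrow> 'a) \<Rightarrow> 'a metric \<Rightarrow>
     'b \<Rightarrow> 'a tvec \<Rightarrow> 'a tvec" where
  "tangential_part A B \<iota> g x w = (THE t. t \<in> sub_tangent A B \<iota> x \<and>
     (\<forall>u\<in>sub_tangent A B \<iota> x. g (\<iota> x) (tcomb 1 w (-1) t) u = 0))"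

definition normal_part ::
  "('a::topological_space, 'e::euclidean_space) atlas \<Rightarrow>
     ('b::topological_space, 'd::euclidean_space) atlas \<Rightarrow> ('b \<Rightarrow> 'a) \<Rightarrow> 'a metric \<Rightarrow>
     'b \<Rightarrow> 'a tvec \<Rightarrow> 'a tvec" where
  "normal_part A B \<iota> g x w = tcomb 1 w (-1) (tangential_part A B \<iota> g x w)"

text \<open>The ambient covariant derivative of fields along \<open>M\<close>, computed at \<open>x\<close> with any ambient
  vector fields extending \<open>X\<close> and \<open>Y\<close> near \<open>x\<close>; since \<open>\<iota>\<close> is locally an embedding, extensions exist,
  and for \<open>X\<close> tangent to \<open>M\<close> the result does not depend on them.\<close>

definition cov_along ::
  "('a::topological_space, 'e::euclidean_space) atlas \<Rightarrow> ('b::topological_space \<Rightarrow> 'a) \<Rightarrow>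
     ('a vfield \<Rightarrow> 'a vfield \<Rightarrow> 'a vfield) \<Rightarrow>
     ('b \<Rightarrow> 'a tvec) \<Rightarrow> ('b \<Rightarrow> 'a tvec) \<Rightarrow> 'b \<Rightarrow> 'a tvec" where
  "cov_along A \<iota> D X Y x = (THE w. \<exists>X' Y' U.
     vector_field A X' \<and> vector_field A Y' \<and> open U \<and> x \<in> U \<and>
     (\<forall>y\<in>U. X' (\<iota> y) = X y \<and> Y' (\<iota> y) = Y y) \<and> w = D X' Y' (\<iota> x))"

text \<open>The Gauss formula splits the ambient derivative into its tangential part, the induced
  connection, and its normal part, the second fundamental form.\<close>

definition second_fundamental_form ::
  "('a::topological_space, 'e::euclidean_space) atlas \<Rightarrow>
     ('b::topological_space, 'd::euclidean_space) atlas \<Rightarrow> ('b \<Rightarrow> 'a) \<Rightarrow> 'a metric \<Rightarrow>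
     ('a vfield \<Rightarrow> 'a vfield \<Rightarrow> 'a vfield) \<Rightarrow>
     ('b \<Rightarrow> 'a tvec) \<Rightarrow> ('b \<Rightarrow> 'a tvec) \<Rightarrow> 'b \<Rightarrow> 'a tvec" where
  "second_fundamental_form A B \<iota> g D X Y x = normal_part A B \<iota> g x (cov_along A \<iota> D X Y x)"

text \<open>The mean curvature vector at \<open>x\<close> is the trace of the second fundamental form divided by the
  dimension of \<open>M\<close>, computed with tangent fields that are orthonormal at \<open>x\<close>; the second
  fundamental form being tensorial, the choice of these fields is immaterial.\<close>

definition mean_curvature ::
  "('a::topological_space, 'e::euclidean_space) atlas \<Rightarrow>
     ('b::topological_space, 'd::euclidean_space) atlas \<Rightarrow> ('b \<Rightarrow> 'a) \<Rightarrow> 'a metric \<Rightarrow>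
     ('a vfield \<Rightarrow> 'a vfield \<Rightarrow> 'a vfield) \<Rightarrow> 'b \<Rightarrow> 'a tvec" where
  "mean_curvature A B \<iota> g D x =
     (let E = (SOME E :: nat \<Rightarrow> 'b \<Rightarrow> 'a tvec.
        (\<forall>i<DIM('d). E i \<in> tangent_fields A B \<iota>) \<and>
        (\<forall>i<DIM('d). \<forall>j<DIM('d). g (\<iota> x) (E i x) (E j x) = (if i = j then 1 else 0)))
      in (\<lambda>f. (\<Sum>i<DIM('d). second_fundamental_form A B \<iota> g D (E i) (E i) x f) / real DIM('d)))"

definition totally_umbilical ::
  "('a::topological_space, 'e::euclidean_space) atlas \<Rightarrow>
     ('b::topological_space, 'd::euclidean_space) atlas \<Rightarrow> ('b \<Rightarrow> 'a) \<Rightarrow> 'a metric \<Rightarrow>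
     ('a vfield \<Rightarrow> 'a vfield \<Rightarrow> 'a vfield) \<Rightarrow> bool" where
  "totally_umbilical A B \<iota> g D \<longleftrightarrow>
     (\<forall>X\<in>tangent_fields A B \<iota>. \<forall>Y\<in>tangent_fields A B \<iota>. \<forall>x.
        second_fundamental_form A B \<iota> g D X Y x
          = (\<lambda>f. g (\<iota> x) (X x) (Y x) * mean_curvature A B \<iota> g D x f))"

definition totally_geodesic ::
  "('a::topological_space, 'e::euclidean_space) atlas \<Rightarrow>
     ('b::topological_space, 'd::euclidean_space) atlas \<Rightarrow> ('b \<Rightarrow> 'a) \<Rightarrow> 'a metric \<Rightarrow>
     ('a vfield \<Rightarrow> 'a vfield \<Rightarrow> 'a vfield) \<Rightarrow> bool" where
  "totally_geodesic A B \<iota> g D \<longleftrightarrow>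
     (\<forall>X\<in>tangent_fields A B \<iota>. \<forall>Y\<in>tangent_fields A B \<iota>. \<forall>x.
        second_fundamental_form A B \<iota> g D X Y x = (\<lambda>_. 0))"


section \<open>Slant submanifolds\<close>

definition invariant_submanifold ::
  "('a::topological_space, 'e::euclidean_space) atlas \<Rightarrow>
     ('b::topological_space, 'd::euclidean_space) atlas \<Rightarrow> ('b \<Rightarrow> 'a) \<Rightarrow> 'a metric \<Rightarrow>
     ('a \<Rightarrow> 'a tvec \<Rightarrow> 'a tvec) \<Rightarrow> bool" where
  "invariant_submanifold A B \<iota> g \<phi> \<longleftrightarrow>
     (\<forall>X\<in>tangent_fields A B \<iota>. \<forall>x. normal_part A B \<iota> g x (\<phi> (\<iota> x) (X x)) = (\<lambda>_. 0))"

definition anti_invariant_submanifold ::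
  "('a::topological_space, 'e::euclidean_space) atlas \<Rightarrow>
     ('b::topological_space, 'd::euclidean_space) atlas \<Rightarrow> ('b \<Rightarrow> 'a) \<Rightarrow> 'a metric \<Rightarrow>
     ('a \<Rightarrow> 'a tvec \<Rightarrow> 'a tvec) \<Rightarrow> bool" where
  "anti_invariant_submanifold A B \<iota> g \<phi> \<longleftrightarrow>
     (\<forall>X\<in>tangent_fields A B \<iota>. \<forall>x. tangential_part A B \<iota> g x (\<phi> (\<iota> x) (X x)) = (\<lambda>_. 0))"

text \<open>The angle in \<open>[0, \<pi>/2]\<close> between a nonzero vector and \<open>T\<^sub>xM\<close>, that is, the angle between the
  vector and its orthogonal projection, or \<open>\<pi>/2\<close> if the projection vanishes.\<close>

definition angle_to_tangent ::
  "('a::topological_space, 'e::euclidean_space) atlas \<Rightarrow>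
     ('b::topological_space, 'd::euclidean_space) atlas \<Rightarrow> ('b \<Rightarrow> 'a) \<Rightarrow> 'a metric \<Rightarrow>
     'b \<Rightarrow> 'a tvec \<Rightarrow> real" where
  "angle_to_tangent A B \<iota> g x w =
     (let t = tangential_part A B \<iota> g x w
      in arccos (sqrt (g (\<iota> x) t t) / sqrt (g (\<iota> x) w w)))"

definition slant_submanifold ::
  "('a::topological_space, 'e::euclidean_space) atlas \<Rightarrow>
     ('b::topological_space, 'd::euclidean_space) atlas \<Rightarrow> ('b \<Rightarrow> 'a) \<Rightarrow> 'a metric \<Rightarrow>
     ('a \<Rightarrow> 'a tvec \<Rightarrow> 'a tvec) \<Rightarrow> 'a vfield \<Rightarrow> real \<Rightarrow> bool" where
  "slant_submanifold A B \<iota> g \<phi> \<xi> \<theta> \<longleftrightarrow>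
     (\<forall>x. \<xi> (\<iota> x) \<in> sub_tangent A B \<iota> x) \<and> \<theta> \<in> {0..pi/2} \<and>
     (\<forall>x. \<forall>u \<in> sub_tangent A B \<iota> x - range (\<lambda>a f. a * \<xi> (\<iota> x) f).
        angle_to_tangent A B \<iota> g x (\<phi> (\<iota> x) u) = \<theta>)"

definition proper_slant_submanifold ::
  "('a::topological_space, 'e::euclidean_space) atlas \<Rightarrow>
     ('b::topological_space, 'd::euclidean_space) atlas \<Rightarrow> ('b \<Rightarrow> 'a) \<Rightarrow> 'a metric \<Rightarrow>
     ('a \<Rightarrow> 'a tvec \<Rightarrow> 'a tvec) \<Rightarrow> 'a vfield \<Rightarrow> bool" where
  "proper_slant_submanifold A B \<iota> g \<phi> \<xi> \<longleftrightarrow>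
     (\<exists>\<theta>. slant_submanifold A B \<iota> g \<phi> \<xi> \<theta>) \<and>
     \<not> invariant_submanifold A B \<iota> g \<phi> \<and> \<not> anti_invariant_submanifold A B \<iota> g \<phi>"

end

theory Submission
  imports Defs
begin

text \<open>Along \<open>M\<close> the structure vector field \<open>\<xi>\<close> is tangent to \<open>M\<close>, and the Kenmotsu identity
  \<open>D X \<xi> = X - \<eta>(X) \<xi>\<close> gives \<open>D \<xi> \<xi> = \<xi> - \<xi> = 0\<close>. Hence \<open>h(\<xi>, \<xi>) = 0\<close>. If \<open>M\<close> is totally umbilical,
  then also \<open>h(\<xi>, \<xi>) = g(\<xi>, \<xi>) H = H\<close>, so that \<open>H = 0\<close>, and therefore \<open>h = g H\<close> vanishes.

  What remains is to see that the objects in this computation are the intended ones.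
  \<^item> The derivative of fields along \<open>M\<close> is computed with arbitrary extensions \<open>X'\<close>, \<open>Y'\<close> of \<open>\<xi>\<close>
    from a piece of \<open>M\<close> to the ambient manifold, and \<open>D X' Y' = D X' \<xi>\<close> is needed on \<open>M\<close>. By
    metric compatibility, \<open>g (D X' Y' - D X' \<xi>) W\<close> is at a point of \<open>M\<close> the derivative of
    \<open>g (Y' - \<xi>) W\<close> in the direction \<open>X'\<close>, which is tangent to \<open>M\<close>, and that function vanishes on \<open>M\<close>;
    choosing for \<open>W\<close> the fields \<open>D X' Y'\<close> and \<open>D X' \<xi>\<close> themselves shows that they agree
    (\<open>connection_agree_along\<close>).
  \<^item> Orthogonal projection of the zero vector is zero because \<open>g\<close> is positive definite on the
    tangent space of \<open>M\<close>. This uses that the differential of \<open>\<iota>\<close> maps tangent vectors to tangent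
    vectors. That, like the smoothness of \<open>\<xi>\<close> as a field along \<open>M\<close>, rests on the smoothness of \<open>f \<circ> \<iota>\<close> for smooth \<open>f\<close>
    (\<open>smooth_fun_on_pullback\<close>), that is, on the chain rule for \<open>C\<^sup>k\<close> maps (\<open>Ck_on_compose\<close>).\<close>

section \<open>Calculus of \<open>C\<^sup>k\<close> maps\<close>

lemma Ck_on_subset: "Ck_on k S f \<Longrightarrow> T \<subseteq> S \<Longrightarrow> Ck_on k T f"
  by (induction k arbitrary: f) (auto intro: continuous_on_subset)

lemma Ck_on_cong:
  assumes "open S" "\<And>x. x \<in> S \<Longrightarrow> f x = h x" "Ck_on k S f"
  shows "Ck_on k S h"
  using assms(2,3)
proof (induction k arbitrary: f h)
  case 0
  then show ?case by (simp cong: continuous_on_cong)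
next
  case (Suc k)
  have der: "(h has_derivative frechet_derivative f (at x)) (at x)" if "x \<in> S" for x
  proof (rule has_derivative_transform_within_open[OF _ assms(1) that])
    show "(f has_derivative frechet_derivative f (at x)) (at x)"
      using Suc.prems(2) that by (simp add: frechet_derivative_works)
  qed (use Suc.prems(1) in auto)
  have "Ck_on k S (\<lambda>x. frechet_derivative h (at x) v)" for v
  proof (rule Suc.IH)
    show "Ck_on k S (\<lambda>x. frechet_derivative f (at x) v)"
      using Suc.prems(2) by simp
    show "frechet_derivative f (at x) v = frechet_derivative h (at x) v" if "x \<in> S" for x
      using frechet_derivative_at[OF der[OF that]] by simp
  qed
  moreover have "h differentiable (at x)" if "x \<in> S" for x
    using der[OF that] by (auto simp: differentiable_def)
  ultimately show ?case by simp
qed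

lemma Ck_on_SucI:
  assumes "open S" and der: "\<And>x. x \<in> S \<Longrightarrow> (f has_derivative f' x) (at x)"
    and "\<And>v. Ck_on k S (\<lambda>x. f' x v)"
  shows "Ck_on (Suc k) S f"
proof -
  have "Ck_on k S (\<lambda>x. frechet_derivative f (at x) v)" for v
    by (rule Ck_on_cong[OF assms(1) _ assms(3)[of v]]) (metis der frechet_derivative_at)
  then show ?thesis
    using der by (auto simp: differentiable_def)
qed

lemma Ck_on_SucD:
  assumes "Ck_on (Suc k) S f"
  shows "x \<in> S \<Longrightarrow> (f has_derivative frechet_derivative f (at x)) (at x)"
    and "Ck_on k S (\<lambda>x. frechet_derivative f (at x) v)"
  using assms by (auto simp: frechet_derivative_works)

lemma Ck_on_Suc_imp_Ck_on: "Ck_on (Suc k) S f \<Longrightarrow> Ck_on k S f"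
proof (induction k arbitrary: f)
  case 0
  then show ?case
    by (auto intro!: differentiable_imp_continuous_on differentiable_at_imp_differentiable_on)
next
  case (Suc k)
  from Suc.prems have "\<forall>x\<in>S. f differentiable (at x)"
    and "\<And>v. Ck_on (Suc k) S (\<lambda>x. frechet_derivative f (at x) v)"
    by auto
  then show ?case using Suc.IH by simp
qed

lemma Ck_on_const: "Ck_on k S (\<lambda>_. a)"
  by (induction k arbitrary: a) auto

lemma Ck_on_add:
  assumes "open S" "Ck_on k S f" "Ck_on k S h"
  shows "Ck_on k S (\<lambda>x. f x + h x)"
  using assms(2,3)
proof (induction k arbitrary: f h)
  case 0
  then show ?case by (auto intro: continuous_on_add)
next
  case (Suc k)
  show ?case
    by (rule Ck_on_SucI[OF assms(1)])
      (auto intro!: has_derivative_add Ck_on_SucD(1)[OF Suc.prems(1)] Ck_on_SucD(1)[OF Suc.prems(2)]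
        Suc.IH Ck_on_SucD(2)[OF Suc.prems(1)] Ck_on_SucD(2)[OF Suc.prems(2)])
qed

lemma Ck_on_sum:
  assumes "open S" "\<And>i. i \<in> I \<Longrightarrow> Ck_on k S (f i)"
  shows "Ck_on k S (\<lambda>x. \<Sum>i\<in>I. f i x)"
  using assms(2)
  by (induction I rule: infinite_finite_induct) (auto intro!: Ck_on_const Ck_on_add[OF assms(1)])

lemma Ck_on_bounded_linear:
  assumes "open S" "bounded_linear L" "Ck_on k S f"
  shows "Ck_on k S (\<lambda>x. L (f x))"
  using assms(3)
proof (induction k arbitrary: f)
  case 0
  then show ?case by (auto intro: bounded_linear.continuous_on[OF assms(2)])
next
  case (Suc k)
  show ?case
    by (rule Ck_on_SucI[OF assms(1)])
      (auto intro!: bounded_linear.has_derivative[OF assms(2)] Ck_on_SucD(1)[OF Suc.prems]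
        Suc.IH Ck_on_SucD(2)[OF Suc.prems])
qed

lemma Ck_on_scaleR:
  assumes "open S" "Ck_on k S f" "Ck_on k S h"
  shows "Ck_on k S (\<lambda>x. f x *\<^sub>R h x)"
  using assms(2,3)
proof (induction k arbitrary: f h)
  case 0
  then show ?case by (auto intro: continuous_on_scaleR)
next
  case (Suc k)
  note lower = Suc.prems[THEN Ck_on_Suc_imp_Ck_on]
  show ?case
    by (rule Ck_on_SucI[OF assms(1)])
      (auto intro!: has_derivative_scaleR Ck_on_SucD(1)[OF Suc.prems(1)] Ck_on_SucD(1)[OF Suc.prems(2)]
        Ck_on_add[OF assms(1)] Suc.IH lower
        Ck_on_SucD(2)[OF Suc.prems(1)] Ck_on_SucD(2)[OF Suc.prems(2)])
qed

text \<open>The induction on \<open>k\<close> needs the derivative \<open>x \<mapsto> f'(G x) (G'(x) v)\<close> as a combination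
  of \<open>C\<^sup>k\<close> maps, but the induction hypothesis covers only composites of a fixed map with \<open>G\<close>,
  and here the argument \<open>G'(x) v\<close> of \<open>f'\<close> varies with \<open>x\<close> as well. Expanding \<open>G'(x) v\<close> in the basis turns it into
  a sum of products of such compositions \<open>x \<mapsto> f'(G x) b\<close> with coordinates of \<open>G'(x) v\<close>.\<close>

lemma Ck_on_compose:
  fixes G :: "'c::euclidean_space \<Rightarrow> 'e::euclidean_space" and f :: "'e \<Rightarrow> 'v::real_normed_vector"
  assumes "open T" "G ` T \<subseteq> S" "Ck_on k T G" "Ck_on k S f"
  shows "Ck_on k T (f \<circ> G)"
  using assms(3,4)
proof (induction k arbitrary: f)
  case 0
  then have "continuous_on T G" "continuous_on S f" by simp_all
  then show ?case
    unfolding Ck_on.simps by (intro continuous_on_compose continuous_on_subset[OF _ assms(2)])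
next
  case (Suc k)
  let ?f' = "\<lambda>y. frechet_derivative f (at y)" and ?G' = "\<lambda>x. frechet_derivative G (at x)"
  show ?case
  proof (rule Ck_on_SucI[OF assms(1)])
    fix x assume x: "x \<in> T"
    have f': "(f has_derivative ?f' (G x)) (at (G x))"
      by (rule Ck_on_SucD(1)[OF Suc.prems(2)]) (use x assms(2) in blast)
    have expand: "?f' (G x) w = (\<Sum>b\<in>Basis. (w \<bullet> b) *\<^sub>R ?f' (G x) b)" for w
    proof -
      have lin: "linear (?f' (G x))" by (rule has_derivative_linear[OF f'])
      have "?f' (G x) w = ?f' (G x) (\<Sum>b\<in>Basis. (w \<bullet> b) *\<^sub>R b)"
        by (simp only: euclidean_representation)
      also have "\<dots> = (\<Sum>b\<in>Basis. (w \<bullet> b) *\<^sub>R ?f' (G x) b)"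
        by (simp only: linear_sum[OF lin] linear_scale[OF lin])
      finally show ?thesis .
    qed
    have "?f' (G x) \<circ> ?G' x = (\<lambda>v. \<Sum>b\<in>Basis. (?G' x v \<bullet> b) *\<^sub>R ((\<lambda>y. ?f' y b) \<circ> G) x)"
      unfolding o_def by (rule ext) (rule expand)
    with diff_chain_at[OF Ck_on_SucD(1)[OF Suc.prems(1) x] f']
    show "(f \<circ> G has_derivative
        (\<lambda>v. \<Sum>b\<in>Basis. (?G' x v \<bullet> b) *\<^sub>R ((\<lambda>y. ?f' y b) \<circ> G) x)) (at x)"
      by (rule has_derivative_eq_rhs)
  next
    fix v
    show "Ck_on k T (\<lambda>x. \<Sum>b\<in>Basis. (?G' x v \<bullet> b) *\<^sub>R ((\<lambda>y. ?f' y b) \<circ> G) x)"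
    proof (intro Ck_on_sum Ck_on_scaleR assms(1))
      show "Ck_on k T (\<lambda>x. ?G' x v \<bullet> b)" for b
        by (rule Ck_on_bounded_linear[OF assms(1) bounded_linear_inner_left
              Ck_on_SucD(2)[OF Suc.prems(1)]])
      show "Ck_on k T (\<lambda>x. ((\<lambda>y. ?f' y b) \<circ> G) x)" for b
        using Suc.IH[OF Ck_on_Suc_imp_Ck_on[OF Suc.prems(1)] Ck_on_SucD(2)[OF Suc.prems(2)]]
        by (simp only: o_def)
    qed
  qed
qed

lemma Ck_on_Union:
  assumes "\<And>S. S \<in> \<S> \<Longrightarrow> open S" "\<And>S. S \<in> \<S> \<Longrightarrow> Ck_on k S f"
  shows "Ck_on k (\<Union>\<S>) f"
  using assms(2)
proof (induction k arbitrary: f)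
  case 0
  then show ?case using assms(1) by (auto intro: continuous_on_open_Union)
next
  case (Suc k)
  then show ?case by fastforce
qed

section \<open>Smooth functions on manifolds\<close>

lemma smooth_manifold_chart:
  assumes "smooth_manifold A" "(U, c) \<in> A"
  shows "open U" "open (c ` U)" "homeomorphism U (c ` U) c (inv_into U c)"
proof -
  have "\<forall>(U, c)\<in>A. open U \<and> open (c ` U) \<and> homeomorphism U (c ` U) c (inv_into U c)"
    using assms(1) unfolding smooth_manifold_def by (elim conjE)
  from bspec[OF this assms(2)]
  show "open U" "open (c ` U)" "homeomorphism U (c ` U) c (inv_into U c)" by simp_all
qed

lemma open_chart_image:
  assumes "smooth_manifold A" "(U, c) \<in> A" "open W"
  shows "open (c ` (U \<inter> W))"
proof -
  note chart = smooth_manifold_chart[OF assms(1,2)]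
  have "openin (top_of_set (c ` U)) (c ` (U \<inter> W))"
    by (rule homeomorphism_imp_open_map[OF chart(3) openin_open_Int[OF assms(3)]])
  then show ?thesis by (rule openin_open_trans) (rule chart(2))
qed

lemma chart_inverse:
  assumes "smooth_manifold A" "(U, c) \<in> A" "z \<in> U"
  shows "inv_into U c (c z) = z"
  by (rule homeomorphism_apply1[OF smooth_manifold_chart(3)[OF assms(1,2)] assms(3)])

lemma smooth_fun_onI:
  assumes "\<And>U c k. (U, c) \<in> A \<Longrightarrow> Ck_on k (c ` (U \<inter> S)) (\<lambda>y. f (inv_into U c y))"
  shows "smooth_fun_on A S f"
  using assms by (auto simp: smooth_fun_on_def smooth_on_def o_def)

lemma smooth_fun_onD:
  assumes "smooth_fun_on A S f" "(U, c) \<in> A"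
  shows "Ck_on k (c ` (U \<inter> S)) (\<lambda>y. f (inv_into U c y))"
  using bspec[OF assms(1)[unfolded smooth_fun_on_def] assms(2)] by (simp add: smooth_on_def o_def)

lemma smooth_fun_on_subset:
  assumes "smooth_fun_on A S f" "T \<subseteq> S"
  shows "smooth_fun_on A T f"
proof (rule smooth_fun_onI)
  fix U c k assume "(U, c) \<in> A"
  then show "Ck_on k (c ` (U \<inter> T)) (\<lambda>y. f (inv_into U c y))"
    by (rule Ck_on_subset[OF smooth_fun_onD[OF assms(1)]]) (use assms(2) in blast)
qed

lemma smooth_fun_on_const: "smooth_fun_on A S (\<lambda>_. a)"
  by (rule smooth_fun_onI) (rule Ck_on_const)

lemma smooth_fun_on_add:
  assumes "smooth_manifold A" "open S" "smooth_fun_on A S f" "smooth_fun_on A S h"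
  shows "smooth_fun_on A S (\<lambda>q. f q + h q)"
  by (intro smooth_fun_onI Ck_on_add open_chart_image[OF assms(1) _ assms(2)]
      smooth_fun_onD[OF assms(3)] smooth_fun_onD[OF assms(4)])

lemma smooth_fun_on_mult:
  assumes "smooth_manifold A" "open S" "smooth_fun_on A S f" "smooth_fun_on A S h"
  shows "smooth_fun_on A S (\<lambda>q. f q * h q)"
proof (rule smooth_fun_onI)
  fix U c k assume c: "(U, c) \<in> A"
  show "Ck_on k (c ` (U \<inter> S)) (\<lambda>y. f (inv_into U c y) * h (inv_into U c y))"
    using Ck_on_scaleR[OF open_chart_image[OF assms(1) c assms(2)]
        smooth_fun_onD[OF assms(3) c] smooth_fun_onD[OF assms(4) c]]
    by simp
qed

lemma smooth_at_const: "smooth_at A p (\<lambda>_. a)"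
  unfolding smooth_at_def by (rule exI[of _ UNIV]) (simp add: smooth_fun_on_const)

lemma smooth_at_common_domain:
  assumes "smooth_at A p f" "smooth_at A p h"
  obtains S where "open S" "p \<in> S" "smooth_fun_on A S f" "smooth_fun_on A S h"
proof -
  obtain S T where "open S" "p \<in> S" "smooth_fun_on A S f" "open T" "p \<in> T" "smooth_fun_on A T h"
    using assms by (auto simp: smooth_at_def)
  then show thesis
    by (intro that[of "S \<inter> T"]) (auto intro: smooth_fun_on_subset)
qed

lemma smooth_at_mult:
  assumes "smooth_manifold A" "smooth_at A p f" "smooth_at A p h"
  shows "smooth_at A p (\<lambda>q. f q * h q)"
proof -
  obtain S where S: "open S" "p \<in> S" "smooth_fun_on A S f" "smooth_fun_on A S h"
    by (rule smooth_at_common_domain[OF assms(2,3)])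
  then have "smooth_fun_on A S (\<lambda>q. f q * h q)"
    by (intro smooth_fun_on_mult assms(1))
  then show ?thesis using S(1,2) unfolding smooth_at_def by blast
qed

lemma smooth_at_linear:
  assumes "smooth_manifold A" "smooth_at A p f" "smooth_at A p h"
  shows "smooth_at A p (\<lambda>q. a * f q + b * h q)"
proof -
  have scaled: "smooth_at A p (\<lambda>q. a * f q)" "smooth_at A p (\<lambda>q. b * h q)"
    by (intro smooth_at_mult smooth_at_const assms)+
  obtain S where S: "open S" "p \<in> S" "smooth_fun_on A S (\<lambda>q. a * f q)"
      "smooth_fun_on A S (\<lambda>q. b * h q)"
    by (rule smooth_at_common_domain[OF scaled])
  then have "smooth_fun_on A S (\<lambda>q. a * f q + b * h q)"
    by (intro smooth_fun_on_add assms(1))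
  then show ?thesis using S(1,2) unfolding smooth_at_def by blast
qed

text \<open>In charts \<open>c\<close> of the domain and \<open>d\<close> of the target, \<open>f \<circ> \<iota>\<close> is
  \<open>(f \<circ> d\<^sup>-\<^sup>1) \<circ> (d \<circ> \<iota> \<circ> c\<^sup>-\<^sup>1)\<close>, to which the chain rule applies. One chart \<open>c\<close> may
  meet the preimages of many charts \<open>d\<close>, so its image is covered by the open pieces on which
  a single \<open>d\<close> serves.\<close>

lemma smooth_fun_on_pullback:
  assumes A: "smooth_manifold A" and B: "smooth_manifold B" and \<iota>: "smooth_map B A \<iota>"
    and S: "open S" and f: "smooth_fun_on A S f"
  shows "smooth_fun_on B (\<iota> -` S) (f \<circ> \<iota>)"
proof (rule smooth_fun_onI)
  fix U c k assume c: "(U, c) \<in> B"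
  let ?P = "\<lambda>V. c ` (U \<inter> \<iota> -` (V \<inter> S))"
  let ?F = "\<lambda>y. (f \<circ> \<iota>) (inv_into U c y)"
  have cont: "open (\<iota> -` W)" if "open W" for W
    using \<iota> that by (auto simp: smooth_map_def intro: open_vimage)
  have "Ck_on k (\<Union>(?P ` fst ` A)) ?F"
  proof (rule Ck_on_Union)
    fix P assume "P \<in> ?P ` fst ` A"
    then obtain V d where d: "(V, d) \<in> A" and P: "P = ?P V" by auto
    have "open V" by (rule smooth_manifold_chart(1)[OF A d])
    then show op: "open P"
      unfolding P using S by (intro open_chart_image[OF B c] cont) auto
    have transition: "Ck_on k P (d \<circ> \<iota> \<circ> inv_into U c)"
    proof (rule Ck_on_subset)
      show "Ck_on k (c ` (U \<inter> \<iota> -` V)) (d \<circ> \<iota> \<circ> inv_into U c)"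
        using \<iota> c d unfolding smooth_map_def smooth_on_def by blast
    qed (use P in blast)
    have local_f: "Ck_on k (d ` (V \<inter> S)) (f \<circ> inv_into V d)"
      using f d by (auto simp: smooth_fun_on_def smooth_on_def)
    have "Ck_on k P ((f \<circ> inv_into V d) \<circ> (d \<circ> \<iota> \<circ> inv_into U c))"
      by (rule Ck_on_compose[OF op _ transition local_f])
        (auto simp: P chart_inverse[OF B c])
    then show "Ck_on k P ?F"
      by (rule Ck_on_cong[OF op, rotated]) (auto simp: P chart_inverse[OF B c] chart_inverse[OF A d])
  qed
  moreover have "c ` (U \<inter> \<iota> -` S) \<subseteq> \<Union>(?P ` fst ` A)"
  proof clarify
    fix z assume z: "z \<in> U" "\<iota> z \<in> S"
    have "\<iota> z \<in> \<Union>(fst ` A)" using A by (simp add: smooth_manifold_def)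
    then show "c z \<in> \<Union>(?P ` fst ` A)" using z by blast
  qed
  ultimately show "Ck_on k (c ` (U \<inter> \<iota> -` S)) ?F"
    by (rule Ck_on_subset)
qed

lemma smooth_at_pullback:
  assumes "smooth_manifold A" "smooth_manifold B" "smooth_map B A \<iota>" "smooth_at A (\<iota> x) f"
  shows "smooth_at B x (f \<circ> \<iota>)"
proof -
  obtain S where S: "open S" "\<iota> x \<in> S" "smooth_fun_on A S f"
    using assms(4) by (auto simp: smooth_at_def)
  moreover have "open (\<iota> -` S)"
    using assms(3) S(1) by (auto simp: smooth_map_def intro: open_vimage)
  ultimately show ?thesis
    using smooth_fun_on_pullback[OF assms(1-3)] unfolding smooth_at_def by auto
qed

section \<open>Tangent vectors and the differential\<close>

lemma vector_field_tangent:
  assumes "vector_field A X"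
  shows "X p \<in> tangent_space A p"
  using assms[unfolded vector_field_def, THEN conjunct1] by (rule spec)

lemma tangent_space_linear:
  assumes "v \<in> tangent_space A p" "smooth_at A p f" "smooth_at A p h"
  shows "v (\<lambda>q. a * f q + b * h q) = a * v f + b * v h"
  using assms by (auto simp: tangent_space_def)

lemma tangent_space_Leibniz:
  assumes "v \<in> tangent_space A p" "smooth_at A p f" "smooth_at A p h"
  shows "v (\<lambda>q. f q * h q) = v f * h p + f p * v h"
  using assms by (auto simp: tangent_space_def)

lemma tangent_space_germ:
  assumes "v \<in> tangent_space A p" "smooth_at A p f" "smooth_at A p h"
    and "open S" "p \<in> S" "\<And>q. q \<in> S \<Longrightarrow> f q = h q"
  shows "v f = v h"
  using assms(1)[unfolded tangent_space_def mem_Collect_eq, THEN conjunct2, THEN spec, THEN spec,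
      THEN mp, OF conjI[OF assms(2,3)], THEN conjunct2, THEN conjunct2, THEN spec, of S] assms(4-6)
  by blast

lemma tangent_space_zero: "(\<lambda>_. 0) \<in> tangent_space A p"
  by (auto simp: tangent_space_def)

lemma tangent_space_tcomb:
  assumes u: "u \<in> tangent_space A p" and v: "v \<in> tangent_space A p"
  shows "tcomb a u b v \<in> tangent_space A p"
  unfolding tangent_space_def mem_Collect_eq
proof (intro conjI allI impI; (elim conjE)?)
  fix f assume "\<not> smooth_at A p f"
  then show "tcomb a u b v f = 0" using u v by (simp add: tangent_space_def tcomb_def)
next
  fix f h assume "smooth_at A p f" "smooth_at A p h"
  note fh = this
  show "tcomb a u b v (\<lambda>q. r * f q + s * h q) = r * tcomb a u b v f + s * tcomb a u b v h" for r s
    by (simp add: tcomb_def tangent_space_linear[OF u fh] tangent_space_linear[OF v fh] algebra_simps)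
  show "tcomb a u b v (\<lambda>q. f q * h q) = tcomb a u b v f * h p + f p * tcomb a u b v h"
    by (simp add: tcomb_def tangent_space_Leibniz[OF u fh] tangent_space_Leibniz[OF v fh] algebra_simps)
  show "tcomb a u b v f = tcomb a u b v h" if "open S" "p \<in> S" "\<forall>q\<in>S. f q = h q" for S
    using tangent_space_germ[OF u fh that(1,2)] tangent_space_germ[OF v fh that(1,2)] that(3)
    by (simp add: tcomb_def)
qed

text \<open>For \<open>f\<close> smooth at \<open>p\<close> this is locality, and otherwise the convention that tangent vectors take
  the value 0 on functions that are not smooth. Covering both cases at once, the lemma applies to
  \<open>f \<circ> \<iota>\<close> before anything is known about its smoothness.\<close>

lemma tangent_vector_locally_zero:
  assumes v: "v \<in> tangent_space A p" and "open S" "p \<in> S" "\<And>q. q \<in> S \<Longrightarrow> f q = 0"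
  shows "v f = 0"
proof (cases "smooth_at A p f")
  case True
  have "v f = v (\<lambda>_. 0)"
    by (rule tangent_space_germ[OF v True smooth_at_const assms(2-4)])
  also have "\<dots> = 0"
    using tangent_space_linear[OF v True True, of 0 0] by simp
  finally show ?thesis .
qed (use v in \<open>simp add: tangent_space_def\<close>)

lemma differential_in_tangent_space:
  assumes A: "smooth_manifold A" and B: "smooth_manifold B" and \<iota>: "smooth_map B A \<iota>"
    and u: "u \<in> tangent_space B x"
  shows "differential A \<iota> x u \<in> tangent_space A (\<iota> x)"
  unfolding tangent_space_def mem_Collect_eq
proof (intro conjI allI impI; (elim conjE)?)
  fix f assume "\<not> smooth_at A (\<iota> x) f"
  then show "differential A \<iota> x u f = 0" by (simp add: differential_def)
next
  fix f h assume fh: "smooth_at A (\<iota> x) f" "smooth_at A (\<iota> x) h"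
  note pb = fh[THEN smooth_at_pullback[OF A B \<iota>]]
  show "differential A \<iota> x u (\<lambda>q. a * f q + b * h q)
      = a * differential A \<iota> x u f + b * differential A \<iota> x u h" for a b
    using tangent_space_linear[OF u pb] smooth_at_linear[OF A fh] fh
    by (simp add: differential_def o_def)
  show "differential A \<iota> x u (\<lambda>q. f q * h q)
      = differential A \<iota> x u f * h (\<iota> x) + f (\<iota> x) * differential A \<iota> x u h"
    using tangent_space_Leibniz[OF u pb] smooth_at_mult[OF A fh] fh
    by (simp add: differential_def o_def)
  show "differential A \<iota> x u f = differential A \<iota> x u h"
    if S: "open S" "\<iota> x \<in> S" "\<forall>q\<in>S. f q = h q" for S
  proof -
    have "open (\<iota> -` S)"
      using \<iota> S(1) by (auto simp: smooth_map_def intro: open_vimage)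
    then have "u (f \<circ> \<iota>) = u (h \<circ> \<iota>)"
      by (rule tangent_space_germ[OF u pb]) (use S in auto)
    then show ?thesis using fh by (simp add: differential_def)
  qed
qed

lemma sub_tangent_subset:
  assumes "immersed_submanifold A B \<iota>"
  shows "sub_tangent A B \<iota> x \<subseteq> tangent_space A (\<iota> x)"
  using assms differential_in_tangent_space
  by (fastforce simp: sub_tangent_def immersed_submanifold_def)

lemma zero_in_sub_tangent: "(\<lambda>_. 0) \<in> sub_tangent A B \<iota> x"
  unfolding sub_tangent_def
  by (rule image_eqI[OF _ tangent_space_zero]) (simp add: differential_def)

lemma restrict_vector_field_along:
  assumes "immersed_submanifold A B \<iota>" "vector_field A X"
  shows "(\<lambda>x. X (\<iota> x)) \<in> fields_along A B \<iota>"
  using assms smooth_fun_on_pullback[of A B \<iota>]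
  unfolding fields_along_def vector_field_def immersed_submanifold_def o_def by blast

section \<open>Metric and connection along a submanifold\<close>

lemma metric_sym:
  assumes "riemannian_metric A g" "u \<in> tangent_space A p" "v \<in> tangent_space A p"
  shows "g p u v = g p v u"
  using assms unfolding riemannian_metric_def by blast

lemma metric_linear_left:
  assumes "riemannian_metric A g"
    and "u \<in> tangent_space A p" "v \<in> tangent_space A p" "w \<in> tangent_space A p"
  shows "g p (tcomb a u b v) w = a * g p u w + b * g p v w"
  using assms unfolding riemannian_metric_def by blast

lemma metric_definite:
  assumes "riemannian_metric A g" "u \<in> tangent_space A p" "g p u u = 0"
  shows "u = (\<lambda>_. 0)"
proof -
  have "u \<noteq> (\<lambda>_. 0) \<longrightarrow> g p u u > 0"
    using assms(1,2) unfolding riemannian_metric_def by blast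
  then show ?thesis using assms(3) by auto
qed

lemma metric_smooth_at:
  assumes "riemannian_metric A g" "vector_field A X" "vector_field A Y"
  shows "smooth_at A p (\<lambda>q. g q (X q) (Y q))"
proof -
  have "smooth_fun_on A UNIV (\<lambda>q. g q (X q) (Y q))"
    using assms(1)[unfolded riemannian_metric_def, THEN conjunct2] assms(2,3) by simp
  then show ?thesis unfolding smooth_at_def by (intro exI[of _ UNIV]) simp
qed

text \<open>Two vectors are separated by pairing with the two vectors themselves. When \<open>u\<close> and \<open>v\<close> are
  values of vector fields, the test vectors are then values of these fields too.\<close>

lemma metric_nondegenerate:
  assumes g: "riemannian_metric A g" and u: "u \<in> tangent_space A p" and v: "v \<in> tangent_space A p"
    and "g p u u = g p v u" "g p u v = g p v v"
  shows "u = v"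
proof -
  let ?w = "tcomb 1 u (-1) v"
  note w = tangent_space_tcomb[OF u v, of 1 "-1"]
  have "g p ?w ?w = g p u ?w - g p v ?w"
    using metric_linear_left[OF g u v w, of 1 "-1"] by simp
  also have "\<dots> = g p ?w u - g p ?w v"
    by (simp add: metric_sym[OF g _ w] u v)
  also have "\<dots> = 0"
    using assms(4,5) metric_sym[OF g u v]
      metric_linear_left[OF g u v u, of 1 "-1"] metric_linear_left[OF g u v v, of 1 "-1"] by simp
  finally have "?w = (\<lambda>_. 0)" by (rule metric_definite[OF g w])
  then show ?thesis by (simp add: tcomb_def fun_eq_iff)
qed

lemma normal_part_zero:
  assumes g: "riemannian_metric A g" and sub: "immersed_submanifold A B \<iota>"
  shows "normal_part A B \<iota> g x (\<lambda>_. 0) = (\<lambda>_. 0)"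
proof -
  note Z = tangent_space_zero[of A "\<iota> x"]
  have "tangential_part A B \<iota> g x (\<lambda>_. 0) = (\<lambda>_. 0)"
    unfolding tangential_part_def
  proof (rule the_equality)
    have "g (\<iota> x) (tcomb 1 (\<lambda>_. 0) (-1) (\<lambda>_. 0)) u = 0" if "u \<in> sub_tangent A B \<iota> x" for u
      using metric_linear_left[OF g Z Z, of u 1 "-1"] that sub_tangent_subset[OF sub] by auto
    then show "(\<lambda>_. 0) \<in> sub_tangent A B \<iota> x \<and>
        (\<forall>u\<in>sub_tangent A B \<iota> x. g (\<iota> x) (tcomb 1 (\<lambda>_. 0) (-1) (\<lambda>_. 0)) u = 0)"
      by (simp add: zero_in_sub_tangent)
  next
    fix t assume "t \<in> sub_tangent A B \<iota> x \<and>
      (\<forall>u\<in>sub_tangent A B \<iota> x. g (\<iota> x) (tcomb 1 (\<lambda>_. 0) (-1) t) u = 0)"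
    then have "g (\<iota> x) (tcomb 1 (\<lambda>_. 0) (-1) t) t = 0" and t: "t \<in> tangent_space A (\<iota> x)"
      using sub_tangent_subset[OF sub] by auto
    moreover have "g (\<iota> x) (\<lambda>_. 0) t = 0"
      using metric_linear_left[OF g Z Z t, of 0 0] by (simp add: tcomb_def)
    ultimately have "g (\<iota> x) t t = 0"
      using metric_linear_left[OF g Z t t, of 1 "-1"] by simp
    then show "t = (\<lambda>_. 0)" by (rule metric_definite[OF g t])
  qed
  then show ?thesis by (simp add: normal_part_def tcomb_def)
qed

lemma levi_civita_vector_field:
  assumes "levi_civita_connection A g D" "vector_field A X" "vector_field A Y"
  shows "vector_field A (D X Y)"
  using assms(1)[unfolded levi_civita_connection_def affine_connection_def] assms(2,3) by simp

lemma levi_civita_metric: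
  assumes "levi_civita_connection A g D" "vector_field A X" "vector_field A Y" "vector_field A Z"
  shows "X p (\<lambda>q. g q (Y q) (Z q)) = g p (D X Y p) (Z p) + g p (Y p) (D X Z p)"
  using assms(1)[unfolded levi_civita_connection_def, THEN conjunct2, THEN conjunct2] assms(2-4)
  by simp

text \<open>The covariant derivative in a direction tangent to \<open>M\<close> sees a field only along \<open>M\<close>. For a
  field \<open>W\<close>, metric compatibility expresses \<open>g (D X Y) W\<close> by \<open>Y\<close> at the point and the derivative
  in the direction \<open>X\<close> of \<open>g Y W\<close>, a function whose restriction to \<open>M\<close> is determined by that of
  \<open>Y\<close>. Testing against \<open>D X Y\<close> and \<open>D X Z\<close> suffices by definiteness.\<close>

lemma connection_agree_along:
  assumes g: "riemannian_metric A g" and LC: "levi_civita_connection A g D"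
    and X: "vector_field A X" and Y: "vector_field A Y" and Z: "vector_field A Z"
    and tangent: "X (\<iota> x) \<in> sub_tangent A B \<iota> x"
    and U: "open U" "x \<in> U" and eq: "\<And>y. y \<in> U \<Longrightarrow> Y (\<iota> y) = Z (\<iota> y)"
  shows "D X Y (\<iota> x) = D X Z (\<iota> x)"
proof -
  note vf = levi_civita_vector_field[OF LC X Y] levi_civita_vector_field[OF LC X Z]
  have test: "g (\<iota> x) (D X Y (\<iota> x)) (W (\<iota> x)) = g (\<iota> x) (D X Z (\<iota> x)) (W (\<iota> x))"
    if W: "vector_field A W" for W
  proof -
    let ?f = "\<lambda>q. g q (Y q) (W q)" and ?h = "\<lambda>q. g q (Z q) (W q)"
    note smooth = metric_smooth_at[OF g Y W] metric_smooth_at[OF g Z W]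
    obtain v where v: "v \<in> tangent_space B x" and Xv: "X (\<iota> x) = differential A \<iota> x v"
      using tangent by (auto simp: sub_tangent_def)
    \<comment> \<open>The coefficients 1 and -1 match the form in which linearity of tangent vectors is stated.\<close>
    have "v ((\<lambda>q. 1 * ?f q + (-1) * ?h q) \<circ> \<iota>) = 0"
      by (rule tangent_vector_locally_zero[OF v U]) (simp add: eq)
    then have "X (\<iota> x) (\<lambda>q. 1 * ?f q + (-1) * ?h q) = 0"
      unfolding Xv by (simp add: differential_def)
    moreover have "X (\<iota> x) \<in> tangent_space A (\<iota> x)"
      by (rule vector_field_tangent[OF X])
    ultimately have "X (\<iota> x) ?f = X (\<iota> x) ?h"
      using tangent_space_linear[OF _ smooth, of "X (\<iota> x)" "\<iota> x" 1 "-1"] by simp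
    then show ?thesis
      unfolding levi_civita_metric[OF LC X Y W] levi_civita_metric[OF LC X Z W] eq[OF U(2)] by simp
  qed
  show ?thesis
  proof (rule metric_nondegenerate[OF g])
    show "D X Y (\<iota> x) \<in> tangent_space A (\<iota> x)" "D X Z (\<iota> x) \<in> tangent_space A (\<iota> x)"
      by (rule vf[THEN vector_field_tangent])+
  qed (rule test[OF vf(1)], rule test[OF vf(2)])
qed

section \<open>Totally umbilical submanifolds tangent to the structure vector field\<close>

text \<open>For every extension \<open>X'\<close> of \<open>\<xi>\<close> from \<open>M\<close>, the derivative \<open>D X' \<xi> = X' - \<eta>(X') \<xi>\<close> is
  \<open>\<xi> - \<xi> = 0\<close> on \<open>M\<close>, and the second argument can be replaced by any extension of \<open>\<xi>\<close> because
  \<open>\<xi>\<close> is tangent to \<open>M\<close>. So the ambient derivative of \<open>\<xi>\<close> along itself is well defined and zero.\<close>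

lemma second_fundamental_form_structure_field:
  assumes K: "kenmotsu_manifold A \<phi> \<xi> \<eta> g D" and sub: "immersed_submanifold A B \<iota>"
    and tangent: "\<And>x. \<xi> (\<iota> x) \<in> sub_tangent A B \<iota> x"
  shows "second_fundamental_form A B \<iota> g D (\<lambda>y. \<xi> (\<iota> y)) (\<lambda>y. \<xi> (\<iota> y)) x = (\<lambda>_. 0)"
proof -
  have g: "riemannian_metric A g" and LC: "levi_civita_connection A g D"
    and \<xi>: "vector_field A \<xi>" and \<eta>: "\<And>p. \<eta> p (\<xi> p) = 1"
    and D\<xi>: "\<And>X p. vector_field A X \<Longrightarrow> D X \<xi> p = tcomb 1 (X p) (- \<eta> p (X p)) (\<xi> p)"
    using K unfolding kenmotsu_manifold_def almost_contact_metric_manifold_def by blast+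
  have zero: "D X \<xi> (\<iota> x) = (\<lambda>_. 0)" if "vector_field A X" "X (\<iota> x) = \<xi> (\<iota> x)" for X
    using that by (simp add: D\<xi> \<eta> tcomb_def)
  have "cov_along A \<iota> D (\<lambda>y. \<xi> (\<iota> y)) (\<lambda>y. \<xi> (\<iota> y)) x = (\<lambda>_. 0)"
    unfolding cov_along_def
  proof (rule the_equality)
    show "\<exists>X' Y' U. vector_field A X' \<and> vector_field A Y' \<and> open U \<and> x \<in> U \<and>
        (\<forall>y\<in>U. X' (\<iota> y) = \<xi> (\<iota> y) \<and> Y' (\<iota> y) = \<xi> (\<iota> y)) \<and> (\<lambda>_. 0) = D X' Y' (\<iota> x)"
      using \<xi> zero[OF \<xi>] by (intro exI[of _ \<xi>] exI[of _ UNIV]) simp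
  next
    fix w
    assume "\<exists>X' Y' U. vector_field A X' \<and> vector_field A Y' \<and> open U \<and> x \<in> U \<and>
        (\<forall>y\<in>U. X' (\<iota> y) = \<xi> (\<iota> y) \<and> Y' (\<iota> y) = \<xi> (\<iota> y)) \<and> w = D X' Y' (\<iota> x)"
    then obtain X' Y' U where X': "vector_field A X'" and Y': "vector_field A Y'"
      and U: "open U" "x \<in> U" and eq: "\<And>y. y \<in> U \<Longrightarrow> X' (\<iota> y) = \<xi> (\<iota> y)"
        "\<And>y. y \<in> U \<Longrightarrow> Y' (\<iota> y) = \<xi> (\<iota> y)" and w: "w = D X' Y' (\<iota> x)"
      by blast
    have "X' (\<iota> x) \<in> sub_tangent A B \<iota> x"
      using eq(1)[OF U(2)] tangent by simp
    then have "w = D X' \<xi> (\<iota> x)"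
      unfolding w by (rule connection_agree_along[OF g LC X' Y' \<xi> _ U eq(2)])
    then show "w = (\<lambda>_. 0)"
      using zero[OF X' eq(1)[OF U(2)]] by simp
  qed
  then show ?thesis
    by (simp add: second_fundamental_form_def normal_part_zero[OF g sub])
qed

theorem theorem3p3:
  fixes A :: "('a::{t2_space,second_countable_topology}, 'e::euclidean_space) atlas"
    and B :: "('b::{t2_space,second_countable_topology}, 'd::euclidean_space) atlas"
    and \<phi> :: "'a \<Rightarrow> 'a tvec \<Rightarrow> 'a tvec" and \<xi> :: "'a vfield" and \<eta> :: "'a \<Rightarrow> 'a tvec \<Rightarrow> real"
    and g :: "'a metric" and D :: "'a vfield \<Rightarrow> 'a vfield \<Rightarrow> 'a vfield" and \<iota> :: "'b \<Rightarrow> 'a"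
  assumes "kenmotsu_manifold A \<phi> \<xi> \<eta> g D"
    and "immersed_submanifold A B \<iota>"
    and "totally_umbilical A B \<iota> g D"
    and "proper_slant_submanifold A B \<iota> g \<phi> \<xi>"
  shows "totally_geodesic A B \<iota> g D"
proof -
  let ?\<xi> = "\<lambda>y. \<xi> (\<iota> y)"
  have tangent: "\<xi> (\<iota> x) \<in> sub_tangent A B \<iota> x" for x
    using assms(4) by (auto simp: proper_slant_submanifold_def slant_submanifold_def)
  have \<xi>: "vector_field A \<xi>" and unit: "g p (\<xi> p) (\<xi> p) = 1" for p
  proof -
    show "vector_field A \<xi>"
      using assms(1) unfolding kenmotsu_manifold_def almost_contact_metric_manifold_def by blast
    then have "\<xi> p \<in> tangent_space A p" by (rule vector_field_tangent)
    then have "\<eta> p (\<xi> p) = g p (\<xi> p) (\<xi> p)" "\<eta> p (\<xi> p) = 1"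
      using assms(1) unfolding kenmotsu_manifold_def almost_contact_metric_manifold_def by blast+
    then show "g p (\<xi> p) (\<xi> p) = 1" by simp
  qed
  have "?\<xi> \<in> tangent_fields A B \<iota>"
    using restrict_vector_field_along[OF assms(2) \<xi>] tangent by (simp add: tangent_fields_def)
  then have "second_fundamental_form A B \<iota> g D ?\<xi> ?\<xi> x
      = (\<lambda>f. g (\<iota> x) (?\<xi> x) (?\<xi> x) * mean_curvature A B \<iota> g D x f)" for x
    using assms(3) unfolding totally_umbilical_def by blast
  \<comment> \<open>The left-hand side is zero and the coefficient of the mean curvature is 1.\<close>
  then have "mean_curvature A B \<iota> g D x = (\<lambda>_. 0)" for x
    by (simp add: second_fundamental_form_structure_field[OF assms(1,2) tangent] unit fun_eq_iff)
  then show ?thesis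
    using assms(3) by (simp add: totally_umbilical_def totally_geodesic_def)
qed

end
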